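(* Let $\mathcal A$ be a unital $C^*$-algebra and let $a\in\mathcal A$ be a normal nonselfadjoint non-invertible element. If $\mathcal S(a,a^* )$ is an SI semigroup, then $C^*(a)$ has nontrivial projections.
   Context: $C^*(a)$ is the $C^*$-subalgebra of $\mathcal A$ generated by $1$ and $a$. A projection is an element $p$ with $p=p^*=p^2$; it is nontrivial if $p\ne0,1$. $\mathcal S(a,a^* )$ is the multiplicative semigroup of all finite nonempty products of $a$ and $a^*$. An ideal of a semigroup $\mathcal S$ is a nonempty subset $J\subset\mathcal S$ with $xb,bx\in J$ for $b\in J$, $x\in\mathcal S$. $\mathcal S$ is an SI (selfadjoint-ideal) semigroup if every ideal $J$ of $\mathcal S$ satisfies $J^*=\{b^*:b\in J\}\subset J$. *)

theory Defs
  imports "HOL-Analysis.Analysis"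
begin

text \<open>
  A type of this class is a nonzero unital complex \<open>C\<^sup>*\<close>-algebra. The superclasses provide a
  unital real Banach algebra with \<open>norm 1 = 1\<close> and submultiplicative norm; complex scalar
  multiplication extends the real one. Only the zero algebra is lost by \<open>norm 1 = 1\<close>, which
  follows from the \<open>C\<^sup>*\<close>-identity as soon as \<open>1 \<noteq> 0\<close>.
\<close>

class unital_cstar_algebra = real_normed_algebra_1 + complete_space +
  fixes scaleC :: "complex \<Rightarrow> 'a \<Rightarrow> 'a"  (infixr \<open>*\<^sub>C\<close> 75)
    and star :: "'a \<Rightarrow> 'a"
  assumes scaleC_add_right: "c *\<^sub>C (x + y) = c *\<^sub>C x + c *\<^sub>C y"
    and scaleC_add_left: "(c + d) *\<^sub>C x = c *\<^sub>C x + d *\<^sub>C x"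
    and scaleC_scaleC: "c *\<^sub>C (d *\<^sub>C x) = (c * d) *\<^sub>C x"
    and scaleC_of_real: "complex_of_real r *\<^sub>C x = r *\<^sub>R x"
    and mult_scaleC_left: "(c *\<^sub>C x) * y = c *\<^sub>C (x * y)"
    and mult_scaleC_right: "x * (c *\<^sub>C y) = c *\<^sub>C (x * y)"
    and norm_scaleC: "norm (c *\<^sub>C x) = cmod c * norm x"
    and star_star: "star (star x) = x"
    and star_add: "star (x + y) = star x + star y"
    and star_scaleC: "star (c *\<^sub>C x) = cnj c *\<^sub>C star x"
    and star_mult: "star (x * y) = star y * star x"
    and cstar_identity: "norm (star x * x) = (norm x)\<^sup>2"

instantiation complex :: unital_cstar_algebra
begin

definition scaleC_complex :: "complex \<Rightarrow> complex \<Rightarrow> complex"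
  where "scaleC_complex c x = c * x"

definition star_complex :: "complex \<Rightarrow> complex"
  where "star_complex x = cnj x"

instance
  by standard
    (auto simp: scaleC_complex_def star_complex_def algebra_simps norm_mult
      scaleR_conv_of_real power2_eq_square)

end

definition selfadjoint :: "'a::unital_cstar_algebra \<Rightarrow> bool"
  where "selfadjoint x \<longleftrightarrow> star x = x"

definition normal_element :: "'a::unital_cstar_algebra \<Rightarrow> bool"
  where "normal_element x \<longleftrightarrow> star x * x = x * star x"

definition invertible_element :: "'a::unital_cstar_algebra \<Rightarrow> bool"
  where "invertible_element x \<longleftrightarrow> (\<exists>y. x * y = 1 \<and> y * x = 1)"

definition projection :: "'a::unital_cstar_algebra \<Rightarrow> bool"
  where "projection p \<longleftrightarrow> star p = p \<and> p * p = p"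

definition nontrivial_projection :: "'a::unital_cstar_algebra \<Rightarrow> bool"
  where "nontrivial_projection p \<longleftrightarrow> projection p \<and> p \<noteq> 0 \<and> p \<noteq> 1"

definition cstar_subalgebra :: "'a::unital_cstar_algebra set \<Rightarrow> bool"
  where "cstar_subalgebra B \<longleftrightarrow>
    0 \<in> B \<and> (\<forall>x\<in>B. \<forall>y\<in>B. x + y \<in> B) \<and> (\<forall>c. \<forall>x\<in>B. c *\<^sub>C x \<in> B) \<and>
    (\<forall>x\<in>B. \<forall>y\<in>B. x * y \<in> B) \<and> (\<forall>x\<in>B. star x \<in> B) \<and> closed B"

definition cstar_generated :: "'a::unital_cstar_algebra \<Rightarrow> 'a set"
  where "cstar_generated a = cstar_subalgebra hull {1, a}"

definition star_semigroup :: "'a::unital_cstar_algebra \<Rightarrow> 'a set"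
  where "star_semigroup a = {prod_list w | w. w \<noteq> [] \<and> set w \<subseteq> {a, star a}}"

definition semigroup_ideal :: "'a::unital_cstar_algebra set \<Rightarrow> 'a set \<Rightarrow> bool"
  where "semigroup_ideal S J \<longleftrightarrow>
    J \<noteq> {} \<and> J \<subseteq> S \<and> (\<forall>b\<in>J. \<forall>x\<in>S. x * b \<in> J \<and> b * x \<in> J)"

definition SI_semigroup :: "'a::unital_cstar_algebra set \<Rightarrow> bool"
  where "SI_semigroup S \<longleftrightarrow>
    (\<forall>x\<in>S. \<forall>y\<in>S. x * y \<in> S) \<and> (\<forall>J. semigroup_ideal S J \<longrightarrow> star ` J \<subseteq> J)"

lemma star_semigroup_mult_closed:
  assumes "x \<in> star_semigroup a" "y \<in> star_semigroup a"
  shows "x * y \<in> star_semigroup a"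
proof -
  obtain v w where "x = prod_list v" "v \<noteq> []" "set v \<subseteq> {a, star a}"
    and "y = prod_list w" "set w \<subseteq> {a, star a}"
    using assms by (auto simp: star_semigroup_def)
  then have "x * y = prod_list (v @ w)" "v @ w \<noteq> []" "set (v @ w) \<subseteq> {a, star a}"
    by auto
  then show ?thesis
    unfolding star_semigroup_def by blast
qed

end

theory Submission
  imports Defs
begin

text \<open>
  Put \<open>h = a\<^sup>* a\<close>. By normality every word \<open>w\<close> of length \<open>n\<close> in \<open>a, a\<^sup>*\<close> satisfies
  \<open>w\<^sup>* w = h\<^sup>n\<close>. The SI property of the principal ideal of \<open>a\<close>, together with \<open>a\<^sup>* \<noteq> a\<close>, writes
  \<open>a\<^sup>*\<close> as a word of length \<open>n + 1 \<ge> 2\<close>, so \<open>h = h\<^sup>n\<^sup>+\<^sup>1\<close>, and \<open>h\<^sup>n\<close> is a projection. It is not \<open>0\<close>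
  because \<open>h = h\<^sup>n h \<noteq> 0\<close>, and not \<open>1\<close> because otherwise \<open>h\<close>, hence \<open>a\<close>, would be invertible.
\<close>

lemma star_zero [simp]: "star (0::'a::unital_cstar_algebra) = 0"
  using star_add[of "0::'a" 0] by simp

lemma star_one [simp]: "star (1::'a::unital_cstar_algebra) = 1"
  using star_mult[of "star (1::'a)" 1] by (simp add: star_star)

lemma star_power: "star (x ^ n) = star x ^ n" for x :: "'a::unital_cstar_algebra"
  by (induction n) (simp_all add: star_mult power_commutes)

lemma star_mult_self_eq_0_iff [simp]:
  "star x * x = 0 \<longleftrightarrow> x = 0" for x :: "'a::unital_cstar_algebra"
  using cstar_identity[of x] by auto

lemma prod_list_commutes:
  fixes x :: "'a::monoid_mult"
  assumes "\<And>y. y \<in> set w \<Longrightarrow> x * y = y * x"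
  shows "x * prod_list w = prod_list w * x"
  using assms
proof (induction w)
  case (Cons y w)
  then have "x * y = y * x" "x * prod_list w = prod_list w * x"
    by simp_all
  then show ?case
    by (simp add: mult.assoc) (metis mult.assoc)
qed simp

text \<open>Peeling off the first letter \<open>y\<close> leaves \<open>star y * y\<close> in the
  middle; by normality this is \<open>star a * a\<close> for either letter, and it commutes with
  both letters, so it can be pulled out past the remaining word.\<close>

lemma star_word_mult_word:
  fixes a :: "'a::unital_cstar_algebra"
  assumes "normal_element a" and "set w \<subseteq> {a, star a}"
  shows "star (prod_list w) * prod_list w = (star a * a) ^ length w"
  using assms(2)
proof (induction w)
  case (Cons y w)
  have n: "star a * a = a * star a"
    using assms(1) by (simp add: normal_element_def)
  have "(star a * a) * a = a * (star a * a)"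
    by (subst n) (rule mult.assoc)
  moreover have "(star a * a) * star a = star a * (star a * a)"
    by (subst (2) n) (rule mult.assoc)
  ultimately have "(star a * a) * z = z * (star a * a)" if "z \<in> set w" for z
    using that Cons.prems by auto
  then have comm: "(star a * a) * prod_list w = prod_list w * (star a * a)"
    by (rule prod_list_commutes)
  have y: "star y * y = star a * a"
    using Cons.prems n by (auto simp: star_star)
  have "star (prod_list (y # w)) * prod_list (y # w)
      = star (prod_list w) * ((star y * y) * prod_list w)"
    by (simp add: star_mult mult.assoc)
  also have "\<dots> = star (prod_list w) * ((star a * a) * prod_list w)"
    by (simp only: y)
  also have "\<dots> = (star (prod_list w) * prod_list w) * (star a * a)"
    by (simp only: comm mult.assoc[of "star (prod_list w)"])
  also have "\<dots> = (star a * a) ^ length (y # w)"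
    using Cons by (simp add: power_commutes)
  finally show ?case .
qed simp

lemma SI_semigroup_star_eq_word:
  fixes a :: "'a::unital_cstar_algebra"
  assumes "normal_element a" and "\<not> selfadjoint a" and "SI_semigroup (star_semigroup a)"
  obtains w where "w \<noteq> []" "set w \<subseteq> {a, star a}" "star a = a * prod_list w"
proof -
  let ?S = "star_semigroup a"
  \<comment> \<open>The principal ideal of \<open>a\<close>. As \<open>?S\<close> is commutative,
    left multiples suffice; \<open>a\<close> is adjoined because \<open>?S\<close> need not contain
    1.\<close>
  let ?J = "insert a ((*) a ` ?S)"
  have aS: "a \<in> ?S"
    unfolding star_semigroup_def by (auto intro!: exI[of _ "[a]"])
  have comm: "a * x = x * a" if "x \<in> ?S" for x
    using that assms(1) unfolding star_semigroup_def normal_element_def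
    by (auto intro!: prod_list_commutes)
  have "semigroup_ideal ?S ?J"
    unfolding semigroup_ideal_def
  proof (intro conjI ballI)
    show "?J \<subseteq> ?S"
      using aS by (auto intro: star_semigroup_mult_closed)
  next
    fix b x assume b: "b \<in> ?J" and x: "x \<in> ?S"
    show "x * b \<in> ?J"
    proof (cases "b = a")
      case False
      then obtain y where y: "y \<in> ?S" "b = a * y"
        using b by auto
      have "x * b = a * (x * y)"
        using y comm[OF x] by (metis mult.assoc)
      then show ?thesis
        using star_semigroup_mult_closed[OF x y(1)] by blast
    qed (use x in \<open>simp flip: comm\<close>)
    show "b * x \<in> ?J"
      using b x by (auto simp: mult.assoc intro: star_semigroup_mult_closed)
  qed simp
  then have "star ` ?J \<subseteq> ?J"
    using assms(3) unfolding SI_semigroup_def by blast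
  \<comment> \<open>The alternative \<open>star a = a\<close> is excluded since \<open>a\<close> is
    not selfadjoint.\<close>
  then have "star a \<in> (*) a ` ?S"
    using assms(2) by (auto simp: selfadjoint_def)
  then show thesis
    using that unfolding star_semigroup_def by auto
qed

lemma cstar_subalgebra_power:
  assumes "cstar_subalgebra B" and "1 \<in> B" and "x \<in> B"
  shows "x ^ n \<in> B"
  using assms by (induction n) (auto simp: cstar_subalgebra_def)

lemma star_mult_self_power_in_cstar_generated: "(star a * a) ^ n \<in> cstar_generated a"
  unfolding cstar_generated_def hull_def
  by (auto intro!: cstar_subalgebra_power) (auto simp: cstar_subalgebra_def)

lemma normal_invertible_if_power_eq_1:
  fixes a :: "'a::unital_cstar_algebra"
  assumes "normal_element a" and "n > 0" and "(star a * a) ^ n = 1"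
  shows "invertible_element a"
proof -
  let ?h = "star a * a"
  obtain m where m: "n = Suc m"
    using assms(2) by (cases n) auto
  have left: "(?h ^ m * star a) * a = 1"
    using assms(3) by (simp add: m power_Suc2 mult.assoc del: power_Suc)
  have "a * (star a * ?h ^ m) = 1"
    using assms(1,3) by (simp add: m normal_element_def mult.assoc)
  \<comment> \<open>A left inverse and a right inverse of the same element coincide.\<close>
  moreover from left this have "?h ^ m * star a = star a * ?h ^ m"
    by (metis mult.assoc mult_1 mult.right_neutral)
  ultimately show ?thesis
    using left unfolding invertible_element_def by auto
qed

theorem corollary4p14:
  fixes a :: "'a::unital_cstar_algebra"
  assumes "normal_element a"
    and "\<not> selfadjoint a"
    and "\<not> invertible_element a"
    and "SI_semigroup (star_semigroup a)"
  shows "\<exists>p \<in> cstar_generated a. nontrivial_projection p"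
proof -
  let ?h = "star a * a"
  obtain w where w: "w \<noteq> []" "set w \<subseteq> {a, star a}" "star a = a * prod_list w"
    using SI_semigroup_star_eq_word assms(1,2,4) by blast
  define n where "n = length w"
  have "n > 0"
    using w(1) by (simp add: n_def)
  then obtain m where m: "n = Suc m"
    using gr0_implies_Suc by blast
  \<comment> \<open>Normality puts \<open>?h\<close> in the form \<open>star x * x\<close> with
    \<open>x = star a\<close>, which is the word \<open>a # w\<close> of length
    \<open>n + 1\<close>.\<close>
  have "?h = star (star a) * star a"
    using assms(1) by (simp add: normal_element_def star_star)
  also have "\<dots> = star (prod_list (a # w)) * prod_list (a # w)"
    using w(3) by simp
  also have "\<dots> = ?h ^ Suc n"
    unfolding n_def using star_word_mult_word[of a "a # w"] assms(1) w(2) by simp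
  finally have h: "?h = ?h ^ Suc n" .
  \<comment> \<open>With \<open>m = n - 1\<close>, the exponent \<open>2 * n\<close> splits as
    \<open>(n + 1) + (n - 1)\<close>, and the first factor collapses to \<open>?h\<close>.\<close>
  have "?h ^ n * ?h ^ n = ?h ^ Suc n * ?h ^ m"
    unfolding m power_add[symmetric] by simp
  also have "\<dots> = ?h ^ n"
    unfolding h[symmetric] by (simp add: m)
  finally have "projection (?h ^ n)"
    by (simp add: projection_def star_power star_mult star_star)
  moreover have "?h ^ n \<noteq> 0"
  proof
    assume "?h ^ n = 0"
    then have "?h = 0"
      using h by (metis mult_zero_right power_Suc)
    \<comment> \<open>The C*-identity turns \<open>?h = 0\<close> into \<open>a = 0\<close>, which
      is selfadjoint.\<close>
    then show False
      using assms(2) by (simp add: selfadjoint_def)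
  qed
  moreover have "?h ^ n \<noteq> 1"
    using normal_invertible_if_power_eq_1[OF assms(1) \<open>n > 0\<close>] assms(3) by blast
  ultimately show ?thesis
    using star_mult_self_power_in_cstar_generated[of a n]
    unfolding nontrivial_projection_def by blast
qed

end
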